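(* Let $\mathcal{H}$ be a finite-dimensional complex Hilbert space, let $\mathbf{X} = (X_1, \dots, X_m)$ be an arbitrary measurement on $\mathcal{H}$, and let $\rho$ be any (pure or mixed) state on $\mathcal{H}$. Then $$H(\mathbf{X},\rho) \;\geq\; -\log_2 \max_{1\le i,j\le m} \|X_i^{1/2} X_j^{1/2}\|,$$ where $\|\cdot\|$ is the operator norm.
   Context: A measurement on a finite-dimensional complex Hilbert space $\mathcal{H}$ is a finite sequence $\mathbf{X} = (X_1,\dots,X_m)$ of positive (i.e. positive semidefinite) operators on $\mathcal{H}$ with $\sum_{i=1}^m X_i = I$. $X^{1/2}$ denotes the positive semidefinite square root of $X$. A state is an operator of the form $\rho = \sum_{i=1}^r \pi_i |\psi_i\rangle\langle\psi_i|$ with $\pi_i > 0$, $\sum_{i=1}^r \pi_i = 1$ and $\psi_1,\dots,\psi_r$ unit vectors in $\mathcal{H}$ (equivalently, a positive semidefinite operator of trace one). The entropy of $\mathbf{X}$ in the state $\rho$ is $H(\mathbf{X},\rho) = -\sum_{k=1}^m p_k \log_2 p_k$ with $p_k = \mathrm{Tr}(\rho X_k)$ and the convention $0\log_2 0 = 0$. *)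

theory Defs
  imports Complex_Main
begin

text \<open>
  The inner product is conjugate-linear in the first and linear in the second argument.
  Completeness is automatic in finite dimension. The parameter \<open>Basis\<close> is inherited from the
  library locale and is any basis of the space as a vector space (not necessarily orthonormal).
\<close>

locale fd_hilbert_space =
  finite_dimensional_vector_space scale Basis
  for scale :: "complex \<Rightarrow> 'h::ab_group_add \<Rightarrow> 'h"
    and Basis :: "'h set" +
  fixes ip :: "'h \<Rightarrow> 'h \<Rightarrow> complex"
  assumes ip_add_right: "ip u (v + w) = ip u v + ip u w"
    and ip_scale_right: "ip u (scale c v) = c * ip u v"
    and ip_commute: "ip u v = cnj (ip v u)"
    and ip_nonneg: "0 \<le> Re (ip v v)"
    and ip_definite: "ip v v = 0 \<Longrightarrow> v = 0"
begin

definition hnorm :: "'h \<Rightarrow> real" where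
  "hnorm v = sqrt (Re (ip v v))"

definition operator :: "('h \<Rightarrow> 'h) \<Rightarrow> bool" where
  "operator A \<longleftrightarrow> Vector_Spaces.linear scale scale A"

definition op_norm :: "('h \<Rightarrow> 'h) \<Rightarrow> real" where
  "op_norm A = (SUP v\<in>{v. hnorm v \<le> 1}. hnorm (A v))"

definition positive_op :: "('h \<Rightarrow> 'h) \<Rightarrow> bool" where
  "positive_op A \<longleftrightarrow>
     operator A \<and> (\<forall>v w. ip (A v) w = ip v (A w)) \<and> (\<forall>v. 0 \<le> Re (ip v (A v)))"

text \<open>Meaningful only for positive \<open>A\<close>, which have exactly one positive square root.\<close>

definition sqrt_op :: "('h \<Rightarrow> 'h) \<Rightarrow> ('h \<Rightarrow> 'h)" where
  "sqrt_op A = (THE B. positive_op B \<and> B \<circ> B = A)"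

text \<open>The value does not depend on the choice of \<open>Basis\<close>.\<close>

definition trace_op :: "('h \<Rightarrow> 'h) \<Rightarrow> complex" where
  "trace_op A = (\<Sum>b\<in>Basis. representation Basis (A b) b)"

text \<open>The rank-one operator \<open>|u\<rangle>\<langle>v|\<close>.\<close>

definition ketbra :: "'h \<Rightarrow> 'h \<Rightarrow> ('h \<Rightarrow> 'h)" where
  "ketbra u v = (\<lambda>x. scale (ip v x) u)"

text \<open>The sequence \<open>X\<^sub>1, \<dots>, X\<^sub>m\<close>; values of \<open>X\<close> outside \<open>{1..m}\<close> are irrelevant.\<close>

definition measurement :: "nat \<Rightarrow> (nat \<Rightarrow> 'h \<Rightarrow> 'h) \<Rightarrow> bool" where
  "measurement m X \<longleftrightarrow>
     (\<forall>i\<in>{1..m}. positive_op (X i)) \<and> (\<lambda>v. \<Sum>i=1..m. X i v) = id"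

definition state :: "('h \<Rightarrow> 'h) \<Rightarrow> bool" where
  "state \<rho> \<longleftrightarrow>
     (\<exists>(r::nat) (p :: nat \<Rightarrow> real) (\<psi> :: nat \<Rightarrow> 'h).
        (\<forall>i\<in>{1..r}. 0 < p i \<and> hnorm (\<psi> i) = 1) \<and>
        (\<Sum>i=1..r. p i) = 1 \<and>
        \<rho> = (\<lambda>v. \<Sum>i=1..r. scale (complex_of_real (p i)) (ketbra (\<psi> i) (\<psi> i) v)))"

text \<open>The trace below is real for a state and a positive operator, so \<open>Re\<close> is only a coercion.\<close>

definition outcome_prob :: "('h \<Rightarrow> 'h) \<Rightarrow> ('h \<Rightarrow> 'h) \<Rightarrow> real" where
  "outcome_prob \<rho> A = Re (trace_op (\<rho> \<circ> A))"

text \<open>The convention \<open>0 log 0 = 0\<close> holds since \<open>0 * x = 0\<close>.\<close>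

definition entropy :: "nat \<Rightarrow> (nat \<Rightarrow> 'h \<Rightarrow> 'h) \<Rightarrow> ('h \<Rightarrow> 'h) \<Rightarrow> real" where
  "entropy m X \<rho> = - (\<Sum>k=1..m. outcome_prob \<rho> (X k) * log 2 (outcome_prob \<rho> (X k)))"

end

end

theory Submission
  imports Defs "HOL-Computational_Algebra.Fundamental_Theorem_Algebra"
begin

text \<open>
  The maximum includes the diagonal pairs \<open>i = j\<close>, so it dominates \<open>\<parallel>X\<^sub>k\<parallel>\<close> and hence every
  outcome probability \<open>p\<^sub>k = \<Sum>\<^sub>i \<pi>\<^sub>i \<langle>\<psi>\<^sub>i, X\<^sub>k \<psi>\<^sub>i\<rangle>\<close>. The bound is therefore a consequence of the
  fact that the Shannon entropy dominates the min-entropy \<open>- log (max p\<^sub>k)\<close>. Square roots are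
  obtained from the spectral theorem, which is proved by showing that every vector, being
  annihilated by a product of factors \<open>A - c\<close>, is a sum of eigenvectors.
\<close>

section \<open>Shannon entropy against min-entropy\<close>

text \<open>The sum is a weighted average of the values \<open>log 2 (p k)\<close> with weights
  \<open>p k\<close> of total 1, and by monotonicity each value of positive weight is at most
  \<open>log 2 M\<close>.\<close>

lemma entropy_ge_min_entropy:
  fixes p :: "'a \<Rightarrow> real"
  assumes "finite S" and nonneg: "\<And>k. k \<in> S \<Longrightarrow> 0 \<le> p k" and total: "(\<Sum>k\<in>S. p k) = 1"
    and le: "\<And>k. k \<in> S \<Longrightarrow> p k \<le> M"
  shows "- log 2 M \<le> - (\<Sum>k\<in>S. p k * log 2 (p k))"
proof -
  have "(\<Sum>k\<in>S. p k * log 2 (p k)) \<le> (\<Sum>k\<in>S. p k * log 2 M)"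
  proof (rule sum_mono)
    fix k assume k: "k \<in> S"
    show "p k * log 2 (p k) \<le> p k * log 2 M"
    proof (cases "p k = 0")
      case False
      then have "0 < p k" using nonneg[OF k] by simp
      with le[OF k] show ?thesis by (intro mult_left_mono) auto
    qed simp
  qed
  also have "\<dots> = log 2 M" using total by (simp flip: sum_distrib_right)
  finally show ?thesis by simp
qed

context fd_hilbert_space
begin

subsection \<open>Inner products and positive operators\<close>

lemma ip_add_left: "ip (u + v) w = ip u w + ip v w"
  by (metis ip_add_right ip_commute complex_cnj_add)

lemma ip_scale_left: "ip (scale c u) v = cnj c * ip u v"
  by (metis ip_scale_right ip_commute complex_cnj_mult)

lemma ip_zero_right [simp]: "ip u 0 = 0"
  using ip_scale_right[of u 0 0] by simp

lemma ip_zero_left [simp]: "ip 0 u = 0"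
  using ip_scale_left[of 0 0 u] by simp

lemma ip_diff_right: "ip u (v - w) = ip u v - ip u w"
  using ip_add_right[of u "v - w" w] by simp

lemma ip_diff_left: "ip (u - v) w = ip u w - ip v w"
  using ip_add_left[of "u - v" v w] by simp

lemma ip_sum_right: "ip u (sum f S) = (\<Sum>x\<in>S. ip u (f x))"
  by (induction S rule: infinite_finite_induct) (simp_all add: ip_add_right)

lemma hnorm_nonneg: "0 \<le> hnorm v"
  by (simp add: hnorm_def ip_nonneg)

lemma hnorm_power2: "(hnorm v)\<^sup>2 = Re (ip v v)"
  by (simp add: hnorm_def ip_nonneg)

lemma ip_self: "ip v v = complex_of_real ((hnorm v)\<^sup>2)"
  unfolding hnorm_power2 by (metis ip_commute Reals_cnj_iff of_real_Re)

text \<open>A one-sided form of Cauchy-Schwarz, which suffices to bound an expectation value by the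
  norm of the image vector.\<close>

lemma Re_ip_le_hnorm:
  assumes "hnorm u = 1"
  shows "Re (ip u v) \<le> hnorm v"
proof (cases "hnorm v = 0")
  case True
  then have "v = 0" using ip_self[of v] by (auto intro: ip_definite)
  then show ?thesis by (simp add: hnorm_nonneg)
next
  case False
  define t where "t = hnorm v"
  have t: "0 < t" using False hnorm_nonneg[of v] by (simp add: t_def)
  \<comment> \<open>Scaling \<open>u\<close> to the length \<open>t\<close> of \<open>v\<close>
    makes both squared norms equal to \<open>t * t\<close>, so \<open>ip w w \<ge> 0\<close> becomes
    \<open>t * Re (ip u v) \<le> t * t\<close>, and \<open>t\<close> cancels.\<close>
  define w where "w = scale (complex_of_real t) u - v"
  have "ip w w = of_real (t * t) * ip u u - of_real t * (ip u v + ip v u) + ip v v"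
    unfolding w_def
    by (simp add: ip_diff_left ip_diff_right ip_scale_left ip_scale_right algebra_simps)
  then have "ip w w = of_real (t * t) - of_real t * (ip u v + ip v u) + of_real (t * t)"
    using assms by (simp add: ip_self t_def power2_eq_square)
  moreover have "Re (ip v u) = Re (ip u v)"
    by (subst ip_commute) simp
  ultimately have "Re (ip w w) = 2 * (t * t - t * Re (ip u v))"
    by (simp add: distrib_left)
  with ip_nonneg[of w] have "t * Re (ip u v) \<le> t * t" by simp
  with t show ?thesis by (simp add: t_def)
qed

lemma operator_iff:
  "operator A \<longleftrightarrow> (\<forall>v w. A (v + w) = A v + A w) \<and> (\<forall>c v. A (scale c v) = scale c (A v))"
  unfolding operator_def Vector_Spaces.linear_iff using vector_space_axioms by blast

lemma operator_add: "operator A \<Longrightarrow> A (v + w) = A v + A w"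
  and operator_scale: "operator A \<Longrightarrow> A (scale c v) = scale c (A v)"
  by (simp_all add: operator_iff)

lemma operator_zero: "operator A \<Longrightarrow> A 0 = 0"
  using operator_scale[of A 0 0] by simp

lemma operator_diff: "operator A \<Longrightarrow> A (v - w) = A v - A w"
  using operator_add[of A "v - w" w] by simp

lemma operator_sum: "operator A \<Longrightarrow> A (sum f S) = (\<Sum>x\<in>S. A (f x))"
  by (induction S rule: infinite_finite_induct) (simp_all add: operator_add operator_zero)

lemma operator_eq_on_span:
  assumes "operator A" "operator B" "v \<in> span S" "\<And>x. x \<in> S \<Longrightarrow> A x = B x"
  shows "A v = B v"
  using assms(3)
proof (induction rule: span_induct_alt)
  case base
  then show ?case using assms by (simp add: operator_zero)
next
  case (step c x y)
  then show ?case using assms by (simp add: operator_add operator_scale)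
qed

definition self_adjoint :: "('h \<Rightarrow> 'h) \<Rightarrow> bool" where
  "self_adjoint A \<longleftrightarrow> operator A \<and> (\<forall>v w. ip (A v) w = ip v (A w))"

lemma self_adjointD:
  assumes "self_adjoint A"
  shows "operator A" "ip (A v) w = ip v (A w)"
  using assms by (auto simp: self_adjoint_def)

lemma positive_op_iff:
  "positive_op A \<longleftrightarrow> self_adjoint A \<and> (\<forall>v. 0 \<le> Re (ip v (A v)))"
  by (auto simp: positive_op_def self_adjoint_def)

text \<open>Moving one factor across the inner product turns \<open>ip v (A (A v))\<close> into
  \<open>ip (A v) (A v)\<close>.\<close>

lemma positive_op_square:
  assumes "self_adjoint A"
  shows "positive_op (A \<circ> A)"
  using assms by (simp add: positive_op_def self_adjoint_def operator_iff ip_nonneg)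
    (metis ip_nonneg)

lemma eigenvalue_real:
  assumes "self_adjoint A" "A v = scale c v" "v \<noteq> 0"
  shows "c \<in> \<real>"
proof -
  have "cnj c * ip v v = c * ip v v"
    using self_adjointD(2)[OF assms(1), of v v] assms(2) by (simp add: ip_scale_left ip_scale_right)
  moreover have "ip v v \<noteq> 0" using assms(3) ip_definite by blast
  ultimately show ?thesis by (simp add: Reals_cnj_iff)
qed

lemma eigenvalue_nonneg:
  assumes "positive_op A" "A v = scale c v" "v \<noteq> 0"
  shows "0 \<le> Re c"
proof -
  have "0 \<le> Re (ip v (A v))" using assms(1) by (simp add: positive_op_def)
  then have "0 \<le> Re c * (hnorm v)\<^sup>2"
    using assms(2) by (simp add: ip_scale_right ip_self)
  moreover have "0 < (hnorm v)\<^sup>2" using assms(3) ip_self[of v] ip_definite[of v] by auto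
  ultimately show ?thesis by (simp add: zero_le_mult_iff)
qed

lemma eigenvectors_orthogonal:
  assumes "self_adjoint A" "A v = scale c v" "A w = scale d w" "c \<noteq> d"
  shows "ip v w = 0"
proof (cases "v = 0")
  case False
  then have "cnj c = c" using eigenvalue_real[OF assms(1,2)] by (simp add: Reals_cnj_iff)
  then have "c * ip v w = d * ip v w"
    using self_adjointD(2)[OF assms(1), of v w] assms(2,3) by (simp add: ip_scale_left ip_scale_right)
  with assms(4) show ?thesis by simp
qed simp

text \<open>Here \<open>y\<close> lies in both the range and the kernel of \<open>A - c\<close>. If
  it were nonzero, \<open>c\<close> would be real, so \<open>A - c\<close> would be symmetric and
  \<open>ip y y = ip ((A - c) y) z = 0\<close>.\<close>

lemma self_adjoint_no_generalized_eigenvectors: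
  assumes "self_adjoint A" and y: "y = A z - scale c z" and Ay: "A y = scale c y"
  shows "y = 0"
proof (rule ccontr)
  assume nz: "y \<noteq> 0"
  have "cnj c = c" using eigenvalue_real[OF assms(1) Ay nz] by (simp add: Reals_cnj_iff)
  then have "ip y y = ip (A y - scale c y) z"
    by (subst (2) y) (simp add: ip_diff_left ip_diff_right ip_scale_left ip_scale_right
        self_adjointD(2)[OF assms(1)])
  then have "ip y y = 0" by (simp add: Ay)
  with nz show False using ip_definite by blast
qed

subsection \<open>Eigenvectors of a self-adjoint operator span the space\<close>

text \<open>Eigenvectors for all eigenvalues are pooled and 0 is included, so membership never
  requires a proof that the vector is nonzero.\<close>

definition eigenvectors :: "('h \<Rightarrow> 'h) \<Rightarrow> 'h set" where
  "eigenvectors A = {v. \<exists>c. A v = scale c v}"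

text \<open>On the span of the eigenvectors, \<open>A - c\<close> is onto up to a remainder
  \<open>y\<close> with \<open>A y = scale c y\<close>. Hence
  \<open>(A - c) v = (A - c) u + y\<close> with \<open>u\<close> in the span; then
  \<open>y = (A - c) (v - u)\<close> vanishes by the previous lemma, and \<open>v - u\<close> is
  itself an eigenvector.\<close>

lemma in_span_eigenvectors_step:
  assumes sa: "self_adjoint A" and "A v - scale c v \<in> span (eigenvectors A)"
  shows "v \<in> span (eigenvectors A)"
proof -
  have op: "operator A" using sa by (rule self_adjointD)
  have split: "\<exists>u\<in>span (eigenvectors A). \<exists>y. w = (A u - scale c u) + y \<and> A y = scale c y"
    if "w \<in> span (eigenvectors A)" for w
    using that
  proof (induction rule: span_induct_alt)
    case base
    show ?case
      by (intro bexI[of _ 0] exI[of _ 0]) (simp_all add: operator_zero[OF op] span_zero)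
  next
    case (step a x w)
    then obtain d where d: "A x = scale d x" by (auto simp: eigenvectors_def)
    from step obtain u y where u: "u \<in> span (eigenvectors A)"
      and w: "w = (A u - scale c u) + y" and y: "A y = scale c y" by blast
    show ?case
    proof (cases "d = c")
      case True
      then have "scale a x + w = (A u - scale c u) + (scale a x + y)"
        "A (scale a x + y) = scale c (scale a x + y)"
        using w y d by (simp_all add: operator_add[OF op] operator_scale[OF op]
            scale_right_distrib mult.commute)
      with u show ?thesis by blast
    next
      case False
      \<comment> \<open>On \<open>x\<close> the operator \<open>A - c\<close> is multiplication by
        \<open>d - c\<close>, so this coefficient gives a preimage of \<open>scale a x\<close>. For
        \<open>d = c\<close> no such preimage is available, and the term goes into the remainder
        instead.\<close>
      define u' where "u' = scale (a / (d - c)) x + u"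
      have "A u' - scale c u' = scale (a / (d - c) * d - c * (a / (d - c))) x + (A u - scale c u)"
        by (simp add: u'_def d operator_add[OF op] operator_scale[OF op] scale_right_distrib
            scale_left_diff_distrib)
      also have "a / (d - c) * d - c * (a / (d - c)) = a"
        using False by (simp add: divide_simps) (simp add: algebra_simps)
      finally have "scale a x + w = (A u' - scale c u') + y" using w by simp
      moreover have "u' \<in> span (eigenvectors A)"
        unfolding u'_def by (intro span_add span_scale u span_base step.hyps)
      ultimately show ?thesis using y by blast
    qed
  qed
  obtain u y where u: "u \<in> span (eigenvectors A)"
    and eq: "A v - scale c v = (A u - scale c u) + y" and y: "A y = scale c y"
    using split[OF assms(2)] by blast
  have "y = A (v - u) - scale c (v - u)"
    using eq by (simp add: operator_diff[OF op] scale_right_diff_distrib algebra_simps)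
  moreover from sa this y have "y = 0" by (rule self_adjoint_no_generalized_eigenvectors)
  ultimately have "v - u \<in> eigenvectors A" by (auto simp: eigenvectors_def)
  with u show ?thesis using span_add[of u _ "v - u"] by (simp add: span_base)
qed

section \<open>Polynomials in an operator and annihilation of vectors\<close>

text \<open>This is \<open>q(A) v\<close>, evaluated by Horner's scheme.\<close>

definition poly_op :: "('h \<Rightarrow> 'h) \<Rightarrow> complex poly \<Rightarrow> 'h \<Rightarrow> 'h" where
  "poly_op A q v = fold_coeffs (\<lambda>a w. scale a v + A w) q 0"

lemma poly_op_0 [simp]: "poly_op A 0 v = 0"
  by (simp add: poly_op_def)

lemma poly_op_pCons:
  assumes "operator A"
  shows "poly_op A (pCons a q) v = scale a v + A (poly_op A q v)"
  \<comment> \<open>\<open>pCons 0 0\<close> collapses to 0 and has no coefficients to fold over;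
    the equation then holds because \<open>A 0 = 0\<close>.\<close>
  by (cases "a = 0 \<and> q = 0") (auto simp: poly_op_def operator_zero[OF assms])

lemma poly_op_add:
  assumes "operator A"
  shows "poly_op A (p + q) v = poly_op A p v + poly_op A q v"
  by (induction p q rule: poly_induct2)
    (simp_all add: poly_op_pCons[OF assms] operator_add[OF assms] scale_left_distrib)

lemma poly_op_smult:
  assumes "operator A"
  shows "poly_op A (smult c q) v = scale c (poly_op A q v)"
  by (induction q)
    (simp_all add: poly_op_pCons[OF assms] operator_scale[OF assms] scale_right_distrib)

lemma poly_op_monom:
  assumes "operator A"
  shows "poly_op A (monom 1 n) v = (A ^^ n) v"
  by (induction n) (simp_all add: monom_0 monom_Suc poly_op_pCons[OF assms] operator_zero[OF assms])

text \<open>Polynomials in \<open>A\<close> commute, so a linear factor can be moved onto the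
  vector; this is what lowers the degree in the induction for
  \<open>span_eigenvectors\<close>.\<close>

lemma poly_op_linear_mult:
  assumes "operator A"
  shows "poly_op A ([:- c, 1:] * q) v = poly_op A q (A v - scale c v)"
proof (induction q)
  case (pCons a q)
  have "[:- c, 1:] * pCons a q = [:- c * a, a:] + pCons 0 ([:- c, 1:] * q)"
    by (simp add: algebra_simps)
  then have "poly_op A ([:- c, 1:] * pCons a q) v
      = poly_op A [:- c * a, a:] v + A (poly_op A ([:- c, 1:] * q) v)"
    by (simp only: poly_op_add[OF assms] poly_op_pCons[OF assms, of 0]) simp
  also have "\<dots> = scale (- c * a) v + A (scale a v) + A (poly_op A q (A v - scale c v))"
    using pCons.IH by (simp add: poly_op_pCons[OF assms] operator_zero[OF assms])
  also have "\<dots> = poly_op A (pCons a q) (A v - scale c v)"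
    by (simp add: poly_op_pCons[OF assms] operator_scale[OF assms] scale_right_diff_distrib
        mult.commute)
  finally show ?case .
qed simp

text \<open>In finite dimension some power \<open>(A ^^ k) v\<close> is a linear combination of the
  earlier ones. The polynomial may depend on \<open>v\<close>.\<close>

lemma exists_annihilating_poly:
  assumes "operator A"
  shows "\<exists>q. q \<noteq> 0 \<and> poly_op A q v = 0"
proof -
  define f where "f k = (A ^^ k) v" for k
  have "\<exists>k. f k \<in> span (f ` {..<k})"
  proof (rule ccontr)
    assume "\<not> ?thesis"
    then have new: "f k \<notin> span (f ` {..<k})" for k by blast
    have "independent (f ` {..<k}) \<and> card (f ` {..<k}) = k" for k
    proof (induction k)
      case (Suc k)
      have "f k \<notin> f ` {..<k}" using new[of k] span_base[of "f k" "f ` {..<k}"] by blast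
      with Suc new[of k] show ?case
        by (auto simp: lessThan_Suc independent_insert)
    qed (simp add: independent_empty)
    \<comment> \<open>One independent vector more than the dimension allows.\<close>
    from this[of "Suc (dim UNIV)"] show False
      using independent_card_le_dim[of "f ` {..<Suc (dim UNIV)}" UNIV] by simp
  qed
  then obtain k where k: "f k \<in> span (f ` {..<k})" by blast
  \<comment> \<open>The vanishing of the coefficients from \<open>k\<close> on keeps the coefficient
    of \<open>monom 1 k\<close> intact below, so that \<open>?r\<close> is nonzero.\<close>
  have "\<exists>q. (\<forall>i\<ge>k. coeff q i = 0) \<and> poly_op A q v = w" if "w \<in> span (f ` {..<k})" for w
    using that
  proof (induction rule: span_induct_alt)
    case base
    show ?case by (intro exI[of _ 0]) simp
  next
    case (step c x y)
    then obtain i q where "i < k" "x = f i" "\<forall>j\<ge>k. coeff q j = 0" "poly_op A q v = y" by blast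
    then show ?case
      by (intro exI[of _ "smult c (monom 1 i) + q"])
        (auto simp: poly_op_add[OF assms] poly_op_smult[OF assms] poly_op_monom[OF assms] f_def)
  qed
  from this[OF k] obtain q where q: "\<forall>i\<ge>k. coeff q i = 0" "poly_op A q v = f k" by blast
  let ?r = "monom 1 k + smult (- 1) q"
  have "coeff ?r k = 1" using q(1) by simp
  then have "?r \<noteq> 0" by force
  moreover have "poly_op A ?r v = 0"
    using q(2) by (simp only: poly_op_add[OF assms] poly_op_smult[OF assms] poly_op_monom[OF assms])
      (simp add: f_def)
  ultimately show ?thesis by blast
qed

text \<open>Induction on the degree of a polynomial annihilating \<open>v\<close>: a complex root
  \<open>c\<close> splits off a factor, the quotient annihilates \<open>A v - scale c v\<close>, and
  \<open>in_span_eigenvectors_step\<close> returns from there to \<open>v\<close>. In degree 0 a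
  nonzero constant annihilates \<open>v\<close>, so \<open>v = 0\<close>.\<close>

lemma span_eigenvectors:
  assumes sa: "self_adjoint A"
  shows "span (eigenvectors A) = UNIV"
proof -
  have op: "operator A" using sa by (rule self_adjointD)
  have *: "v \<in> span (eigenvectors A)" if "q \<noteq> 0" "poly_op A q v = 0" for q v
    using that
  proof (induction "degree q" arbitrary: q v)
    case 0
    then obtain a where "q = [:a:]" "a \<noteq> 0" by (metis degree_eq_zeroE pCons_0_0)
    with 0 have "v = 0" by (simp add: poly_op_pCons[OF op] operator_zero[OF op])
    then show ?case by (simp add: span_zero)
  next
    case (Suc n)
    then have "\<not> constant (poly q)" by (simp add: constant_degree)
    then obtain c where "poly q c = 0" using fundamental_theorem_of_algebra by blast
    then obtain r where r: "q = [:- c, 1:] * r" by (auto simp: poly_eq_0_iff_dvd dvd_def)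
    then have "r \<noteq> 0" using Suc.prems(1) by auto
    moreover from this have "n = degree r"
      using Suc.hyps(2) unfolding r by (subst (asm) degree_mult_eq) auto
    moreover have "poly_op A r (A v - scale c v) = 0"
      using Suc.prems(2) by (simp only: r poly_op_linear_mult[OF op])
    ultimately have "A v - scale c v \<in> span (eigenvectors A)"
      using Suc.hyps(1) by blast
    with sa show ?case by (rule in_span_eigenvectors_step)
  qed
  show ?thesis using * exists_annihilating_poly[OF op] by blast
qed

subsection \<open>Square roots\<close>

text \<open>\<open>T f\<close> plays the role of \<open>f(A)\<close>: it is the linear extension
  from a basis \<open>B\<close> of eigenvectors. \<open>B\<close> need not be orthogonal inside an
  eigenspace, but \<open>T f\<close> is a scalar there, which is enough for symmetry.\<close>

lemma exists_functional_calculus: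
  assumes sa: "self_adjoint A"
  obtains B ev T where "span B = UNIV" "\<And>b. b \<in> B \<Longrightarrow> b \<noteq> 0"
    "\<And>b. b \<in> B \<Longrightarrow> A b = scale (complex_of_real (ev b)) b"
    "\<And>f. self_adjoint (T f)"
    "\<And>f b. b \<in> B \<Longrightarrow> T f b = scale (complex_of_real (f (ev b))) b"
proof -
  interpret pair: vector_space_pair scale scale ..
  obtain B where B: "B \<subseteq> eigenvectors A" "independent B" "eigenvectors A \<subseteq> span B"
    by (rule maximal_independent_subset)
  have span: "span B = UNIV"
    using span_mono[OF B(3)] span_eigenvectors[OF sa] by (auto simp: span_span)
  have nz: "b \<noteq> 0" if "b \<in> B" for b using B(2) dependent_zero that by blast
  have "\<exists>t::real. A b = scale (complex_of_real t) b" if "b \<in> B" for b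
  proof -
    obtain c where c: "A b = scale c b"
      using B(1) \<open>b \<in> B\<close> unfolding eigenvectors_def by blast
    have "c \<in> \<real>" using eigenvalue_real[OF sa c nz[OF that]] .
    with c show ?thesis by (auto elim: Reals_cases)
  qed
  then obtain ev :: "'h \<Rightarrow> real" where
    ev: "\<And>b. b \<in> B \<Longrightarrow> A b = scale (complex_of_real (ev b)) b" by metis
  have "\<exists>T. operator T \<and> (\<forall>b\<in>B. T b = scale (complex_of_real (f (ev b))) b)"
    for f :: "real \<Rightarrow> real"
    unfolding operator_def by (rule pair.linear_independent_extend[OF B(2)])
  then obtain T :: "(real \<Rightarrow> real) \<Rightarrow> 'h \<Rightarrow> 'h" where T: "\<And>f. operator (T f)"
    "\<And>f b. b \<in> B \<Longrightarrow> T f b = scale (complex_of_real (f (ev b))) b" by metis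
  \<comment> \<open>For equal eigenvalues both sides carry the same real factor; for different ones
    both vanish by orthogonality. Symmetry is then extended by linearity, one argument at a
    time.\<close>
  have sym_basis: "ip (T f b) b' = ip b (T f b')" if "b \<in> B" "b' \<in> B" for f b b'
  proof (cases "ev b = ev b'")
    case True
    then show ?thesis using that by (simp add: T(2) ip_scale_left ip_scale_right)
  next
    case False
    then have "ip b b' = 0"
      using eigenvectors_orthogonal[OF sa ev[OF that(1)] ev[OF that(2)]] by simp
    then show ?thesis using that by (simp add: T(2) ip_scale_left ip_scale_right)
  qed
  have sym_left: "ip (T f v) b' = ip v (T f b')" if "v \<in> span B" "b' \<in> B" for f v b'
    using that(1)
    by (induction rule: span_induct_alt)
      (simp_all add: operator_zero[OF T(1)] operator_add[OF T(1)] operator_scale[OF T(1)]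
        ip_add_left ip_scale_left sym_basis that(2))
  have sym: "ip (T f v) w = ip v (T f w)" if "w \<in> span B" for f v w
    using that
    by (induction rule: span_induct_alt)
      (simp_all add: operator_zero[OF T(1)] operator_add[OF T(1)] operator_scale[OF T(1)]
        ip_add_right ip_scale_right sym_left span)
  have "self_adjoint (T f)" for f
    unfolding self_adjoint_def using T(1) sym by (simp add: span)
  with that span nz ev T(2) show thesis by blast
qed

lemma sqrt_exists:
  assumes "positive_op A"
  shows "\<exists>S. positive_op S \<and> S \<circ> S = A"
proof -
  have sa: "self_adjoint A" using assms by (simp add: positive_op_iff)
  obtain B ev T where span: "span B = UNIV" and nz: "\<And>b. b \<in> B \<Longrightarrow> b \<noteq> 0"
    and ev: "\<And>b. b \<in> B \<Longrightarrow> A b = scale (complex_of_real (ev b)) b"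
    and T: "\<And>f. self_adjoint (T f)"
    and T_eq: "\<And>f b. b \<in> B \<Longrightarrow> T f b = scale (complex_of_real (f (ev b))) b"
    using exists_functional_calculus[OF sa] by blast
  \<comment> \<open>The square of the fourth root is positive because the fourth root is self-adjoint.\<close>
  define Q where "Q = T (\<lambda>t. sqrt (sqrt t))"
  have Q: "self_adjoint Q" unfolding Q_def by (rule T)
  have pos: "positive_op (Q \<circ> Q)" by (rule positive_op_square[OF Q])
  have "(Q \<circ> Q \<circ> (Q \<circ> Q)) b = A b" if "b \<in> B" for b
  proof -
    \<comment> \<open>The real function \<open>sqrt\<close> is odd, so the fourth power of the
      iterated root recovers only nonnegative numbers.\<close>
    have ge: "0 \<le> ev b" using eigenvalue_nonneg[OF assms ev[OF that] nz[OF that]] by simp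
    have "sqrt (sqrt (ev b)) * sqrt (sqrt (ev b)) * (sqrt (sqrt (ev b)) * sqrt (sqrt (ev b))) = ev b"
      using ge by simp
    then show ?thesis
      using that by (simp add: Q_def T_eq operator_scale[OF self_adjointD(1)[OF T]] ev ge
          mult.assoc flip: of_real_mult)
  qed
  moreover have "operator (Q \<circ> Q \<circ> (Q \<circ> Q))"
    using self_adjointD(1)[OF Q] by (simp add: operator_iff)
  ultimately have "(Q \<circ> Q \<circ> (Q \<circ> Q)) v = A v" for v
    using operator_eq_on_span[of "Q \<circ> Q \<circ> (Q \<circ> Q)" A v B] self_adjointD(1)[OF sa] span by blast
  then have "Q \<circ> Q \<circ> (Q \<circ> Q) = A" by blast
  with pos show ?thesis by blast
qed

text \<open>It suffices to compare on the eigenvectors of \<open>S\<close>, which span. If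
  \<open>S e = scale c e\<close>, then \<open>T (T e) = scale (c * c) e\<close>, that is
  \<open>(T + c) (T - c) e = 0\<close>, and the aim is \<open>(T - c) e = 0\<close>.\<close>

lemma sqrt_unique:
  assumes S: "positive_op S" and T: "positive_op T" and eq: "S \<circ> S = T \<circ> T"
  shows "S = T"
proof
  fix v
  have sS: "self_adjoint S" and sT: "self_adjoint T" using S T by (simp_all add: positive_op_iff)
  note oS = self_adjointD(1)[OF sS] and oT = self_adjointD(1)[OF sT]
  have "S e = T e" if "e \<in> eigenvectors S" for e
  proof (cases "e = 0")
    case False
    obtain c where c: "S e = scale c e" using \<open>e \<in> eigenvectors S\<close> by (auto simp: eigenvectors_def)
    have real: "c \<in> \<real>" and nonneg: "0 \<le> Re c"
      using eigenvalue_real[OF sS c False] eigenvalue_nonneg[OF S c False] by auto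
    have TT: "T (T e) = scale (c * c) e"
      using fun_cong[OF eq, of e] by (simp add: c operator_scale[OF oS])
    define y where "y = T e - scale c e"
    have Ty: "T y = scale (- c) y"
      by (simp add: y_def operator_diff[OF oT] operator_scale[OF oT] TT scale_right_diff_distrib)
    have "y = 0"
    proof (cases "c = 0")
      case True
      \<comment> \<open>For \<open>c = 0\<close> the vector \<open>y = T e\<close> lies in the range
        and the kernel of \<open>T\<close>.\<close>
      with y_def Ty show ?thesis by (intro self_adjoint_no_generalized_eigenvectors[OF sT, of y e 0]) auto
    next
      case c0: False
      show ?thesis
      proof (rule ccontr)
        assume "y \<noteq> 0"
        \<comment> \<open>A nonzero \<open>y\<close> would make \<open>- c\<close> an eigenvalue of
          the positive operator \<open>T\<close>, while \<open>Re c\<close> is nonnegative as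
          well.\<close>
        from eigenvalue_nonneg[OF T Ty this] nonneg have "Re c = 0" by simp
        with real c0 show False by (metis of_real_Re of_real_0)
      qed
    qed
    then show ?thesis by (simp add: y_def c)
  qed (simp add: operator_zero oS oT)
  then show "S v = T v"
    using operator_eq_on_span[OF oS oT, of v "eigenvectors S"] span_eigenvectors[OF sS] by blast
qed

lemma sqrt_op:
  assumes "positive_op A"
  shows positive_sqrt_op: "positive_op (sqrt_op A)" and sqrt_op_square: "sqrt_op A \<circ> sqrt_op A = A"
proof -
  have "\<exists>!S. positive_op S \<and> S \<circ> S = A"
    using sqrt_exists[OF assms] sqrt_unique by metis
  from theI'[OF this] show "positive_op (sqrt_op A)" "sqrt_op A \<circ> sqrt_op A = A"
    by (simp_all add: sqrt_op_def)
qed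

subsection \<open>Outcome probabilities\<close>

text \<open>The root \<open>S\<close> of \<open>X k\<close> is a contraction, because
  \<open>ip u (X k u)\<close> is one of the nonnegative terms summing to \<open>ip u u\<close>;
  applying \<open>S\<close> twice gives the claim.\<close>

lemma measurement_effect_contraction:
  assumes X: "measurement m X" and k: "k \<in> {1..m}"
  shows "hnorm (X k v) \<le> hnorm v"
proof -
  have pos: "positive_op (X i)" if "i \<in> {1..m}" for i
    using X that by (auto simp: measurement_def)
  have total: "(\<Sum>i=1..m. X i u) = u" for u
    using X by (auto simp: measurement_def dest: fun_cong)
  define S where "S = sqrt_op (X k)"
  have S: "self_adjoint S" "\<And>u. S (S u) = X k u"
    using positive_sqrt_op[OF pos[OF k]] fun_cong[OF sqrt_op_square[OF pos[OF k]]]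
    by (auto simp: S_def positive_op_iff)
  have "hnorm (S u) \<le> hnorm u" for u
  proof -
    have "(hnorm (S u))\<^sup>2 = Re (ip u (X k u))"
      by (simp add: hnorm_power2 self_adjointD(2)[OF S(1)] S(2))
    also have "\<dots> \<le> (\<Sum>i=1..m. Re (ip u (X i u)))"
      using pos by (intro member_le_sum k) (auto simp: positive_op_def)
    also have "\<dots> = Re (ip u (\<Sum>i=1..m. X i u))" by (simp add: ip_sum_right)
    also have "\<dots> = (hnorm u)\<^sup>2" by (simp only: total hnorm_power2)
    finally show ?thesis using hnorm_nonneg by (rule power2_le_imp_le)
  qed
  from this[of "S v"] this[of v] show ?thesis by (simp add: S(2))
qed

text \<open>The supremum is an upper bound only for a set that is bounded above; the contraction
  hypothesis supplies the bound 1.\<close>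

lemma hnorm_le_op_norm:
  assumes "\<And>v. hnorm (A v) \<le> hnorm v" "hnorm v \<le> 1"
  shows "hnorm (A v) \<le> op_norm A"
  unfolding op_norm_def
proof (rule cSUP_upper)
  show "bdd_above ((\<lambda>v. hnorm (A v)) ` {v. hnorm v \<le> 1})"
    using assms(1) by (intro bdd_aboveI[of _ 1]) (auto intro: order_trans)
qed (use assms in simp)

text \<open>The coordinates of \<open>\<psi> i\<close> in \<open>Basis\<close> act as weights on the
  numbers \<open>ip (\<psi> i) (A b)\<close>; by linearity of \<open>A\<close> the sum over
  \<open>b\<close> reassembles \<open>A (\<psi> i)\<close>. These are linear coordinates, not inner
  products, as \<open>Basis\<close> may fail to be orthonormal.\<close>

lemma trace_op_ensemble:
  assumes A: "operator A"
    and \<rho>: "\<rho> = (\<lambda>v. \<Sum>i=1..r. scale (complex_of_real (p i)) (ketbra (\<psi> i) (\<psi> i) v))"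
  shows "trace_op (\<rho> \<circ> A) = (\<Sum>i=1..r. complex_of_real (p i) * ip (\<psi> i) (A (\<psi> i)))"
proof -
  let ?rep = "representation Basis"
  have rep: "?rep (\<rho> (A b)) b = (\<Sum>i=1..r. complex_of_real (p i) * (ip (\<psi> i) (A b) * ?rep (\<psi> i) b))" for b
    by (simp add: \<rho> ketbra_def representation_sum representation_scale independent_Basis span_Basis mult.assoc)
  have expand: "(\<Sum>b\<in>Basis. ip u (A b) * ?rep w b) = ip u (A w)" for u w
  proof -
    have "w = (\<Sum>b\<in>Basis. scale (?rep w b) b)"
      using sum_representation_eq[OF independent_Basis _ finite_Basis] span_Basis by simp
    then have "ip u (A w) = ip u (A (\<Sum>b\<in>Basis. scale (?rep w b) b))" by simp
    also have "\<dots> = (\<Sum>b\<in>Basis. ip u (A b) * ?rep w b)"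
      by (simp add: operator_sum[OF A] operator_scale[OF A] ip_sum_right ip_scale_right mult.commute)
    finally show ?thesis by simp
  qed
  have "trace_op (\<rho> \<circ> A)
      = (\<Sum>b\<in>Basis. \<Sum>i=1..r. complex_of_real (p i) * (ip (\<psi> i) (A b) * ?rep (\<psi> i) b))"
    by (simp add: trace_op_def rep)
  also have "\<dots> = (\<Sum>i=1..r. \<Sum>b\<in>Basis. complex_of_real (p i) * (ip (\<psi> i) (A b) * ?rep (\<psi> i) b))"
    by (rule sum.swap)
  also have "\<dots> = (\<Sum>i=1..r. complex_of_real (p i) * ip (\<psi> i) (A (\<psi> i)))"
    by (simp add: expand flip: sum_distrib_left)
  finally show ?thesis .
qed

lemma entropy_lower_bound:
  assumes X: "measurement m X" and st: "state \<rho>"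
  shows "- log 2 (Max {op_norm (sqrt_op (X i) \<circ> sqrt_op (X j)) | i j. i \<in> {1..m} \<and> j \<in> {1..m}})
    \<le> entropy m X \<rho>"
proof -
  obtain r :: nat and p :: "nat \<Rightarrow> real" and \<psi> :: "nat \<Rightarrow> 'h"
    where p: "\<And>i. i \<in> {1..r} \<Longrightarrow> 0 < p i" and unit: "\<And>i. i \<in> {1..r} \<Longrightarrow> hnorm (\<psi> i) = 1"
      and p_total: "(\<Sum>i=1..r. p i) = 1"
      and \<rho>: "\<rho> = (\<lambda>v. \<Sum>i=1..r. scale (complex_of_real (p i)) (ketbra (\<psi> i) (\<psi> i) v))"
    using st unfolding state_def by blast
  have pos: "positive_op (X k)" if "k \<in> {1..m}" for k
    using X that by (auto simp: measurement_def)
  have total: "(\<Sum>k=1..m. X k u) = u" for u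
    using X by (auto simp: measurement_def dest: fun_cong)
  have prob: "outcome_prob \<rho> (X k) = (\<Sum>i=1..r. p i * Re (ip (\<psi> i) (X k (\<psi> i))))"
    if "k \<in> {1..m}" for k
    using pos[OF that] by (simp add: outcome_prob_def trace_op_ensemble[OF _ \<rho>] positive_op_def)
  let ?N = "{op_norm (sqrt_op (X i) \<circ> sqrt_op (X j)) | i j. i \<in> {1..m} \<and> j \<in> {1..m}}"
  have fin: "finite ?N"
    by (rule finite_subset[of _ "(\<lambda>(i, j). op_norm (sqrt_op (X i) \<circ> sqrt_op (X j))) ` ({1..m} \<times> {1..m})"])
      auto
  have le: "outcome_prob \<rho> (X k) \<le> Max ?N" if k: "k \<in> {1..m}" for k
  proof -
    have "outcome_prob \<rho> (X k) \<le> (\<Sum>i=1..r. p i * op_norm (X k))"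
      unfolding prob[OF k]
    proof (intro sum_mono mult_left_mono)
      fix i assume i: "i \<in> {1..r}"
      have "Re (ip (\<psi> i) (X k (\<psi> i))) \<le> hnorm (X k (\<psi> i))"
        by (rule Re_ip_le_hnorm[OF unit[OF i]])
      also have "\<dots> \<le> op_norm (X k)"
        using measurement_effect_contraction[OF X k] unit[OF i] by (intro hnorm_le_op_norm) auto
      finally show "Re (ip (\<psi> i) (X k (\<psi> i))) \<le> op_norm (X k)" .
      show "0 \<le> p i" using p[OF i] by simp
    qed
    \<comment> \<open>The mixing weights sum to 1. The diagonal pair \<open>i = j = k\<close> then
      identifies this norm as a member of \<open>?N\<close>.\<close>
    also have "\<dots> = op_norm (X k)" by (simp only: p_total mult_1 flip: sum_distrib_right)
    also have "\<dots> = op_norm (sqrt_op (X k) \<circ> sqrt_op (X k))"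
      by (simp add: sqrt_op_square[OF pos[OF k]])
    also have "\<dots> \<le> Max ?N" using k by (intro Max_ge fin) blast
    finally show ?thesis .
  qed
  have nonneg: "0 \<le> outcome_prob \<rho> (X k)" if k: "k \<in> {1..m}" for k
    unfolding prob[OF k] using p pos[OF k]
    by (intro sum_nonneg mult_nonneg_nonneg) (auto simp: positive_op_def less_imp_le)
  \<comment> \<open>Swapping the sums lets the effects add up to the identity for each unit vector
    \<open>\<psi> i\<close>, which leaves the total mixing weight 1.\<close>
  have "(\<Sum>k=1..m. outcome_prob \<rho> (X k))
      = (\<Sum>i=1..r. \<Sum>k=1..m. p i * Re (ip (\<psi> i) (X k (\<psi> i))))"
    using prob by (subst sum.swap) simp
  also have "\<dots> = (\<Sum>i=1..r. p i * Re (ip (\<psi> i) (\<Sum>k=1..m. X k (\<psi> i))))"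
    by (simp only: ip_sum_right Re_sum sum_distrib_left)
  also have "\<dots> = (\<Sum>i=1..r. p i)"
    by (intro sum.cong refl) (simp only: total unit one_power2 mult_1_right flip: hnorm_power2)
  finally have "(\<Sum>k=1..m. outcome_prob \<rho> (X k)) = 1" by (simp only: p_total)
  then show ?thesis
    unfolding entropy_def using nonneg le by (intro entropy_ge_min_entropy) auto
qed

end

theorem mainTheorem4:
  fixes scale :: "complex \<Rightarrow> 'h::ab_group_add \<Rightarrow> 'h"
    and Basis :: "'h set"
    and ip :: "'h \<Rightarrow> 'h \<Rightarrow> complex"
    and m :: nat
    and X :: "nat \<Rightarrow> 'h \<Rightarrow> 'h"
    and \<rho> :: "'h \<Rightarrow> 'h"
  assumes "fd_hilbert_space scale Basis ip"
    and "fd_hilbert_space.measurement scale ip m X"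
    and "fd_hilbert_space.state scale ip \<rho>"
  shows "fd_hilbert_space.entropy scale Basis m X \<rho> \<ge>
    - log 2 (Max {fd_hilbert_space.op_norm ip
                    (fd_hilbert_space.sqrt_op scale ip (X i) \<circ>
                     fd_hilbert_space.sqrt_op scale ip (X j)) | i j.
                  i \<in> {1..m} \<and> j \<in> {1..m}})"
  using fd_hilbert_space.entropy_lower_bound[OF assms] .

end
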